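(* Let $k\geq2$ be an integer and let $w_1=01\cdots(k-1)$. For all $i>1$ let \[ w_i=\Big(\prod_{j=1}^{i-1}w_{i-j}^{p_{i,i-j}}\Big)k \] for some nonnegative integers $p_{i,\ell}$ ($1\le \ell<i$). If $p_{i,\ell}\geq p_{i+1,\ell}$ for all pairs $(i,\ell)$ with $1\leq\ell<i$ and $p_{i,1}\geq1$ for all $i\ge2$, then $w=\lim_{i\to\infty}w_i$ is a strongly Fergusonian representation word, and its representation sequence is $(1,k=|w_1|,|w_2|,|w_3|,\ldots)$.
   Context: Products denote concatenation of words, $u^p$ is $u$ repeated $p$ times. A representing sequence is a strictly increasing sequence $(a_i)_{i\ge0}$ of positive integers with $a_0=1$. For $n\ge1$ with $a_j\le n<a_{j+1}$, the $(a_i)$-representation of $n$ is the digit string $d_j\cdots d_0$ with $n=\sum d_ia_i$ and $\sum d_i$ minimal (greedy); the representation of $0$ is the digit $0$. $n\ge0$ is $2$-volatile if the representation of $n+1$ ends in at least two zeros. The representation word of $(a_i)$ is the infinite word $w$ with $w[n]=a_1$ if $n$ is $2$-volatile and otherwise $w[n]$ equals the last digit of the representation of $n$. A word is a representation word if it is the representation word of some representing sequence, called a representation sequence of the word. A word over $\{0,\dots,k\}$ ($k\ge2$) is Fergusonian if for every $0\le i<k-1$ every occurrence of $i$ is immediately followed by $i+1$ and every occurrence of $i+1$ is immediately preceded by $i$; strongly Fergusonian if moreover it contains no two consecutive $k$'s.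
   Formalization: The formal theorem additionally assumes p_{i,i-1} ≥ 1 for all i ≥ 2; without it some |w_{i+1}| ≤ |w_i|, so the lengths are not a representing sequence (and the limit may be finite). Representations are the greedy ones. *)

theory Defs
  imports Complex_Main
begin

text \<open>Finite words are lists, infinite words are functions on \<^typ>\<open>nat\<close>; letters and
  digits are natural numbers. Digit strings have the most significant digit first.\<close>

definition word_pow :: "'a list \<Rightarrow> nat \<Rightarrow> 'a list" where
  "word_pow u m = concat (replicate m u)"

definition word_lim :: "(nat \<Rightarrow> 'a list) \<Rightarrow> (nat \<Rightarrow> 'a) \<Rightarrow> bool" where
  "word_lim ws w \<longleftrightarrow>
     (\<forall>n. eventually (\<lambda>i. n < length (ws i) \<and> ws i ! n = w n) sequentially)"

definition representing_sequence :: "(nat \<Rightarrow> nat) \<Rightarrow> bool" where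
  "representing_sequence a \<longleftrightarrow> a 0 = 1 \<and> strict_mono a"

primrec greedy_digits :: "(nat \<Rightarrow> nat) \<Rightarrow> nat \<Rightarrow> nat \<Rightarrow> nat list" where
  "greedy_digits a 0 n = [n div a 0]"
| "greedy_digits a (Suc j) n = (n div a (Suc j)) # greedy_digits a j (n mod a (Suc j))"

text \<open>Minimality of the digit sum is meant in the greedy sense (each digit, from the top down,
  is as large as possible): for the sequence 1, 3, 4, 8, ... the number 6 is written 102,
  although 20 has a smaller digit sum.\<close>

definition representation :: "(nat \<Rightarrow> nat) \<Rightarrow> nat \<Rightarrow> nat list" where
  "representation a n =
     (if n = 0 then [0] else greedy_digits a (THE j. a j \<le> n \<and> n < a (Suc j)) n)"

definition two_volatile :: "(nat \<Rightarrow> nat) \<Rightarrow> nat \<Rightarrow> bool" where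
  "two_volatile a n \<longleftrightarrow> (\<exists>ds. representation a (n + 1) = ds @ [0, 0])"

definition representation_word_of :: "(nat \<Rightarrow> nat) \<Rightarrow> nat \<Rightarrow> nat" where
  "representation_word_of a n = (if two_volatile a n then a 1 else last (representation a n))"

text \<open>A word may have several representation sequences: the word with period 0, 1, 0, 2
  belongs to every sequence 1, 2, 4, ... in which each term divides the next one.\<close>

definition representation_sequence_of :: "(nat \<Rightarrow> nat) \<Rightarrow> (nat \<Rightarrow> nat) \<Rightarrow> bool" where
  "representation_sequence_of w a \<longleftrightarrow> representing_sequence a \<and> representation_word_of a = w"

definition representation_word :: "(nat \<Rightarrow> nat) \<Rightarrow> bool" where
  "representation_word w \<longleftrightarrow> (\<exists>a. representation_sequence_of w a)"

definition fergusonian :: "nat \<Rightarrow> (nat \<Rightarrow> nat) \<Rightarrow> bool" where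
  "fergusonian k w \<longleftrightarrow>
     (\<forall>n. w n \<le> k) \<and>
     (\<forall>i < k - 1.
        (\<forall>n. w n = i \<longrightarrow> w (n + 1) = i + 1) \<and>
        (\<forall>n. w n = i + 1 \<longrightarrow> n > 0 \<and> w (n - 1) = i))"

definition strongly_fergusonian :: "nat \<Rightarrow> (nat \<Rightarrow> nat) \<Rightarrow> bool" where
  "strongly_fergusonian k w \<longleftrightarrow>
     fergusonian k w \<and> (\<forall>n. \<not> (w n = k \<and> w (n + 1) = k))"

text \<open>For words built as below with exponents \<^term>\<open>p\<close> decreasing in the first argument, the
  condition \<open>p i (i - 1) \<ge> 1\<close> is necessary for the lengths to be strictly increasing, hence for
  them to form a representing sequence.\<close>

lemma top_exponent_pos:
  fixes p :: "nat \<Rightarrow> nat \<Rightarrow> nat" and ws :: "nat \<Rightarrow> nat list"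
  assumes ws: "\<And>i. i > 1 \<Longrightarrow>
      ws i = concat (map (\<lambda>j. word_pow (ws (i - j)) (p i (i - j))) [1..<i]) @ [k]"
    and dec: "\<And>i l. 1 \<le> l \<Longrightarrow> l < i \<Longrightarrow> p i l \<ge> p (i + 1) l"
    and p1: "\<And>i. i \<ge> 2 \<Longrightarrow> p i 1 \<ge> 1"
    and incr: "representing_sequence (\<lambda>i. if i = 0 then 1 else length (ws i))"
    and "i \<ge> 2"
  shows "p i (i - 1) \<ge> 1"
proof (cases "i = 2")
  case True
  then show ?thesis using p1[of 2] by simp
next
  case False
  define m where "m = i - 1"
  with False \<open>i \<ge> 2\<close> have i: "i = Suc m" "m \<ge> 2" by auto
  have len: "length (ws n) = (\<Sum>l\<in>{1..<n}. p n l * length (ws l)) + 1" if "n > 1" for n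
  proof -
    have "length (ws n) = (\<Sum>j\<in>{1..<n}. p n (n - j) * length (ws (n - j))) + 1"
      by (subst ws[OF that])
         (simp add: word_pow_def length_concat o_def sum_list_replicate
            sum_list_distinct_conv_sum_set)
    also have "(\<Sum>j\<in>{1..<n}. p n (n - j) * length (ws (n - j))) =
        (\<Sum>l\<in>{1..<n}. p n l * length (ws l))"
      by (rule sum.reindex_bij_witness[of _ "\<lambda>l. n - l" "\<lambda>l. n - l"]) auto
    finally show ?thesis .
  qed
  have "length (ws m) < length (ws (Suc m))"
    using incr i(2) unfolding representing_sequence_def strict_mono_Suc_iff
    by (auto dest!: spec[of _ m] split: if_splits)
  moreover have "(\<Sum>l\<in>{1..<m}. p (Suc m) l * length (ws l)) \<le>
      (\<Sum>l\<in>{1..<m}. p m l * length (ws l))"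
    by (rule sum_mono, rule mult_right_mono) (use dec[of _ m] in auto)
  ultimately have "p (Suc m) m \<noteq> 0"
    using len[of m] len[of "Suc m"] i(2) by (intro notI) simp
  then show ?thesis using i by simp
qed

end

theory Submission
  imports Defs
begin

text \<open>Write \<open>a\<^sub>0 = 1\<close> and \<open>a\<^sub>i = |w\<^sub>i|\<close>, and let \<open>L\<close> be the representation word of \<open>a\<close>. Greediness
  gives \<open>L (q a\<^sub>j + r) = L r\<close> whenever \<open>r < a\<^sub>j\<close> and \<open>q a\<^sub>j + r + 1 < a\<^bsub>j+1\<^esub>\<close>, while
  \<open>L (a\<^sub>j - 1) = k\<close> for \<open>j \<ge> 2\<close>. The monotonicity of the exponents bounds the tail
  \<open>w\<^sub>m\<^bsup>p(i,m)\<^esup> \<cdots> w\<^sub>1\<^bsup>p(i,1)\<^esup> k\<close> of \<open>w\<^sub>i\<close> by \<open>a\<^bsub>m+1\<^esub>\<close> in length, so reading a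
  position of \<open>w\<^sub>i\<close> block by block is the greedy algorithm, and every \<open>w\<^sub>i\<close> is a prefix of \<open>L\<close>.
  The word is strongly Fergusonian because \<open>p(i,1) \<ge> 1\<close> makes every \<open>w\<^sub>i\<close> a
  concatenation of the blocks \<open>0 1 \<cdots> (k-1)\<close> and \<open>0 1 \<cdots> (k-1) k\<close>.\<close>

section \<open>Greedy digits\<close>

lemma length_greedy_digits [simp]: "length (greedy_digits a j n) = Suc j"
  by (induction j arbitrary: n) auto

lemma greedy_digits_neq_Nil [simp]: "greedy_digits a j n \<noteq> []"
  using length_greedy_digits[of a j n] by (metis length_0_conv nat.distinct(1))

text \<open>All of \<open>a (Suc i)\<close>, ..., \<open>a j\<close> exceed \<open>n\<close>, so
  their quotients are 0 and the remainder stays \<open>n\<close>. Digits can thus be read from any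
  sufficiently high index, without knowing the leading position.\<close>

lemma greedy_digits_leading_zeros:
  assumes "strict_mono a" "i \<le> j" "n < a (Suc i)"
  shows "greedy_digits a j n = replicate (j - i) 0 @ greedy_digits a i n"
  using assms(2)
proof (induction j rule: dec_induct)
  case (step j)
  have "n < a (Suc j)"
    using assms(3) strict_mono_less_eq[OF assms(1), of "Suc i" "Suc j"] step(1) by linarith
  then show ?case using step by (simp add: Suc_diff_le)
qed simp

definition ends_00 :: "nat list \<Rightarrow> bool" where
  "ends_00 ds \<longleftrightarrow> (\<exists>es. ds = es @ [0, 0])"

lemma ends_00_snoc_snoc: "ends_00 (ds @ [x, y]) \<longleftrightarrow> x = 0 \<and> y = 0"
  by (auto simp: ends_00_def)

lemma last_ends_00: "ends_00 ds \<Longrightarrow> last ds = 0"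
  by (auto simp: ends_00_def)

lemma ends_00_append:
  assumes "length ds \<ge> 2"
  shows "ends_00 (es @ ds) = ends_00 ds"
proof -
  obtain xs y where y: "ds = xs @ [y]" using assms by (cases ds rule: rev_cases) auto
  then obtain zs x where "xs = zs @ [x]" using assms by (cases xs rule: rev_cases) auto
  then have "ds = zs @ [x, y]" using y by simp
  then show ?thesis
    using ends_00_snoc_snoc[of zs x y] ends_00_snoc_snoc[of "es @ zs" x y] by simp
qed

lemma ends_00_Cons: "length ds \<ge> 2 \<Longrightarrow> ends_00 (d # ds) = ends_00 ds"
  using ends_00_append[of ds "[d]"] by simp

lemma ends_00_zero: "j \<ge> 1 \<Longrightarrow> ends_00 (greedy_digits a j 0)"
proof (induction j rule: dec_induct)
  case base
  show ?case by (simp add: ends_00_def)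
next
  case (step j)
  then show ?case by (simp add: ends_00_Cons)
qed

lemma ends_00_greedy_digits_Suc:
  "j \<ge> 1 \<Longrightarrow> ends_00 (greedy_digits a (Suc j) n) = ends_00 (greedy_digits a j (n mod a (Suc j)))"
  by (simp add: ends_00_Cons)

lemma ends_00_greedy_digits_1:
  "a 0 = 1 \<Longrightarrow> ends_00 (greedy_digits a (Suc 0) n) \<longleftrightarrow> n = 0"
  using ends_00_snoc_snoc[of "[]" "n div a 1" "n mod a 1"] by (auto elim!: dvdE split: if_splits)

section \<open>The representation word\<close>

lemma representation_eq_greedy_digits:
  assumes "representing_sequence a" "a j \<le> n" "n < a (Suc j)"
  shows "representation a n = greedy_digits a j n"
proof -
  have m: "strict_mono a" and a0: "a 0 = 1"
    using assms(1) by (auto simp: representing_sequence_def)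
  have "a 0 \<le> a j" using strict_mono_less_eq[OF m, of 0 j] by simp
  then have "n > 0" using a0 assms(2) by simp
  moreover have "(THE j. a j \<le> n \<and> n < a (Suc j)) = j"
  proof (rule the_equality)
    fix i assume i: "a i \<le> n \<and> n < a (Suc i)"
    then have "a i < a (Suc j)" "a j < a (Suc i)" using assms by linarith+
    then show "i = j" using strict_mono_less[OF m] by (metis less_SucE less_asym)
  qed (use assms in auto)
  ultimately show ?thesis by (simp add: representation_def)
qed

lemma representing_sequence_bracket:
  assumes "representing_sequence a" "0 < n" "n < a (Suc j)"
  obtains i where "i \<le> j" "a i \<le> n" "n < a (Suc i)"
proof -
  have "\<exists>i\<le>j. a i \<le> n \<and> n < a (Suc i)" using assms(3)
  proof (induction j)
    case 0
    then show ?case using assms by (auto simp: representing_sequence_def)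
  next
    case (Suc j)
    then show ?case by (cases "n < a (Suc j)") (auto intro: le_SucI)
  qed
  then show thesis using that by blast
qed

lemma last_representation:
  assumes "representing_sequence a" "n < a (Suc j)"
  shows "last (representation a n) = last (greedy_digits a j n)"
proof (cases "n = 0")
  case True
  have "last (greedy_digits a j 0) = 0" by (induction j) auto
  with True show ?thesis by (simp add: representation_def)
next
  case False
  then obtain i where i: "i \<le> j" "a i \<le> n" "n < a (Suc i)"
    using representing_sequence_bracket assms by blast
  then show ?thesis
    using representation_eq_greedy_digits[OF assms(1) i(2,3)] assms(1)
      greedy_digits_leading_zeros[of a, OF _ i(1,3)]
    by (simp add: representing_sequence_def)
qed

text \<open>Padding with zeros could create a false ending 00 only for a one-digit representation.
  That digit is \<open>n + 1\<close>, which is nonzero.\<close>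

lemma two_volatile_iff:
  assumes "representing_sequence a" "j \<ge> 1" "n + 1 < a (Suc j)"
  shows "two_volatile a n \<longleftrightarrow> ends_00 (greedy_digits a j (n + 1))"
proof -
  obtain i where i: "i \<le> j" "a i \<le> n + 1" "n + 1 < a (Suc i)"
    using representing_sequence_bracket[of a "n + 1" j] assms by auto
  have gd: "greedy_digits a j (n + 1) = replicate (j - i) 0 @ greedy_digits a i (n + 1)"
    using greedy_digits_leading_zeros[of a, OF _ i(1,3)] assms(1)
    by (simp add: representing_sequence_def)
  have "two_volatile a n \<longleftrightarrow> ends_00 (greedy_digits a i (n + 1))"
    using representation_eq_greedy_digits[OF assms(1) i(2,3)]
    by (simp add: two_volatile_def ends_00_def)
  also have "\<dots> \<longleftrightarrow> ends_00 (greedy_digits a j (n + 1))"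
  proof (cases "i = 0")
    case False
    then show ?thesis unfolding gd by (subst ends_00_append) auto
  next
    \<comment> \<open>Both strings end in the nonzero digit \<open>n + 1\<close>, so neither side of
      the equivalence holds.\<close>
    case True
    have "a 0 = 1" using assms(1) by (simp add: representing_sequence_def)
    then show ?thesis unfolding gd True by (auto dest!: last_ends_00)
  qed
  finally show ?thesis .
qed

text \<open>Even the largest such \<open>n\<close> is not volatile: its successor \<open>a 1\<close>
  is written 10, with a single final zero.\<close>

lemma representation_word_of_less_base:
  assumes "representing_sequence a" "n < a 1"
  shows "representation_word_of a n = n"
proof -
  have a: "a 0 = 1" "a 1 < a 2"
    using assms(1) by (auto simp: representing_sequence_def strict_mono_def)
  then have "\<not> two_volatile a n"
    using two_volatile_iff[OF assms(1), of 1 n] assms(2) ends_00_greedy_digits_1[of a]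
    by (simp add: numeral_2_eq_2)
  then show ?thesis
    using last_representation[OF assms(1), of n 0] assms(2) a
    by (simp add: representation_word_of_def)
qed

text \<open>The representation of \<open>a j\<close> is a 1 followed by \<open>j\<close> zeros, and
  \<open>j\<close> is at least 2.\<close>

lemma representation_word_of_pred:
  assumes "representing_sequence a" "j \<ge> 2"
  shows "representation_word_of a (a j - 1) = a 1"
proof -
  obtain i where i: "j = Suc i" "i \<ge> 1" using assms(2) by (cases j) auto
  have m: "a j < a (Suc j)" "a 0 < a j"
    using assms strict_monoD[of a 0 j] strict_monoD[of a j "Suc j"]
    by (auto simp: representing_sequence_def)
  then have "two_volatile a (a j - 1)"
    using two_volatile_iff[OF assms(1), of j "a j - 1"] assms(2) i
      ends_00_greedy_digits_Suc[of i a "a j"] ends_00_zero[of i a]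
    by simp
  then show ?thesis by (simp add: representation_word_of_def)
qed

text \<open>Below index \<open>j\<close> the greedy digits of a number depend only on its residue
  modulo \<open>a j\<close>. The bound on \<open>n + 1\<close> keeps the successor, which decides
  volatility, expandable from index \<open>j\<close>.\<close>

lemma representation_word_of_mod:
  assumes a: "representing_sequence a" and j: "j \<ge> 1" and n: "n + 1 < a (Suc j)"
  shows "representation_word_of a n = representation_word_of a (n mod a j)"
proof -
  obtain i where i: "j = Suc i" using j by (cases j) auto
  let ?r = "n mod a j"
  have m: "a j < a (Suc j)" "a 0 < a j" "a 0 = 1"
    using a j strict_monoD[of a 0 j] strict_monoD[of a j "Suc j"]
    by (auto simp: representing_sequence_def)
  \<comment> \<open>The successor of the remainder may equal \<open>a j\<close>; it is still below
    \<open>a (Suc j)\<close>, so both successors are expanded from index \<open>j\<close>.\<close>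
  then have r: "?r < a j" "?r + 1 < a (Suc j)" using mod_less_divisor[of "a j" n] by linarith+
  have "last (representation a n) = last (representation a ?r)"
    using last_representation[OF a, of n j] last_representation[OF a, of ?r i] n r i by simp
  moreover have "two_volatile a n = two_volatile a ?r"
  proof -
    have "two_volatile a n = ends_00 (greedy_digits a j (n + 1))"
      "two_volatile a ?r = ends_00 (greedy_digits a j (?r + 1))"
      using two_volatile_iff[OF a j n] two_volatile_iff[OF a j r(2)] .
    moreover have "ends_00 (greedy_digits a j (n + 1)) = ends_00 (greedy_digits a j (?r + 1))"
    proof (cases "i = 0")
      \<comment> \<open>With only two digits, 00 would mean the number 0, but both successors are
        positive.\<close>
      case True
      then show ?thesis using i ends_00_greedy_digits_1[of a, OF m(3)] by simp
    next
      case False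
      then show ?thesis unfolding i
        by (subst (1 2) ends_00_greedy_digits_Suc) (auto simp: mod_Suc_eq)
    qed
    ultimately show ?thesis by simp
  qed
  ultimately show ?thesis by (simp add: representation_word_of_def)
qed

section \<open>Tails of the block words\<close>

lemma length_word_pow [simp]: "length (word_pow u m) = m * length u"
  by (simp add: word_pow_def length_concat sum_list_replicate)

lemma word_pow_Suc: "word_pow u (Suc m) = u @ word_pow u m"
  by (simp add: word_pow_def)

lemma word_pow_Suc_right: "word_pow u (Suc m) = word_pow u m @ u"
  by (induction m) (simp_all add: word_pow_def)

lemma nth_word_pow: "n < m * length u \<Longrightarrow> word_pow u m ! n = u ! (n mod length u)"
proof (induction m arbitrary: n)
  case (Suc m)
  then show ?case
    by (cases "n < length u") (auto simp: word_pow_Suc nth_append le_mod_geq)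
qed simp

text \<open>With \<open>q\<close> equal to \<open>p i\<close>, this is the suffix of
  \<open>ws i\<close> left after removing the powers of \<open>ws (i - 1)\<close>, ...,
  \<open>ws (Suc m)\<close>; for \<open>m = i - 1\<close> it is all of \<open>ws i\<close>.\<close>

primrec word_tail :: "(nat \<Rightarrow> 'a list) \<Rightarrow> (nat \<Rightarrow> nat) \<Rightarrow> 'a \<Rightarrow> nat \<Rightarrow> 'a list" where
  "word_tail ws q k 0 = [k]"
| "word_tail ws q k (Suc m) = word_pow (ws (Suc m)) (q (Suc m)) @ word_tail ws q k m"

lemma word_tail_eq_concat:
  "m < i \<Longrightarrow> concat (map (\<lambda>j. word_pow (ws (i - j)) (q (i - j))) [i - m..<i]) @ [k]
     = word_tail ws q k m"
proof (induction m)
  case (Suc m)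
  then have "[i - Suc m..<i] = (i - Suc m) # [i - m..<i]"
    by (simp add: upt_conv_Cons Suc_diff_Suc)
  with Suc show ?case by simp
qed simp

lemma length_word_tail_mono:
  "(\<And>l. 1 \<le> l \<Longrightarrow> l \<le> m \<Longrightarrow> q l \<le> q' l) \<Longrightarrow>
     length (word_tail ws q k m) \<le> length (word_tail ws q' k m)"
  by (induction m) (auto intro!: add_mono mult_right_mono)

lemma word_tail_neq_Nil [simp]: "word_tail ws q k m \<noteq> []"
  by (induction m) auto

lemma last_word_tail [simp]: "last (word_tail ws q k m) = k"
  by (induction m) auto

text \<open>The last letter is excluded because a tail may have length exactly
  \<open>a (Suc m)\<close>, and its last position would then violate the bound in
  \<open>representation_word_of_mod\<close>.\<close>

lemma nth_word_tail_eq_representation_word_of: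
  assumes a: "representing_sequence a"
    and pre: "\<And>l n. 1 \<le> l \<Longrightarrow> l \<le> m \<Longrightarrow> n < a l \<Longrightarrow> ws l ! n = representation_word_of a n"
    and len: "\<And>l. 1 \<le> l \<Longrightarrow> l \<le> m \<Longrightarrow> length (ws l) = a l"
    and tail: "\<And>l. l \<le> m \<Longrightarrow> length (word_tail ws q k l) \<le> a (Suc l)"
    and n: "n + 1 < length (word_tail ws q k m)"
  shows "word_tail ws q k m ! n = representation_word_of a n"
  using pre len tail n
proof (induction m arbitrary: n)
  case (Suc m)
  let ?a = "a (Suc m)"
  have pos: "0 < ?a" using a strict_monoD[of a 0 "Suc m"] by (simp add: representing_sequence_def)
  have len: "length (ws (Suc m)) = ?a" using Suc.prems(2)[of "Suc m"] by simp
  have "n + 1 < a (Suc (Suc m))" using Suc.prems(3)[of "Suc m"] Suc.prems(4) by simp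
  then have L: "representation_word_of a n = representation_word_of a (n mod ?a)"
    using representation_word_of_mod[OF a, of "Suc m" n] by simp
  show ?case
  proof (cases "n < q (Suc m) * ?a")
    case True
    then show ?thesis
      using L len pos Suc.prems(1)[of "Suc m" "n mod ?a"] by (simp add: nth_append nth_word_pow)
  next
    case False
    define r where "r = n - q (Suc m) * ?a"
    have r: "n = q (Suc m) * ?a + r" using False by (simp add: r_def)
    have rl: "r + 1 < length (word_tail ws q k m)" using Suc.prems(4) len r by simp
    \<comment> \<open>The bound on the shorter tail makes \<open>r\<close> the true remainder, so
      \<open>q (Suc m)\<close> is the digit that the greedy algorithm chooses.\<close>
    then have "r < ?a" using Suc.prems(3)[of m] by simp
    then have "n mod ?a = r" using r by simp
    moreover have "word_tail ws q k m ! r = representation_word_of a r"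
      using Suc.IH[OF _ _ _ rl] Suc.prems(1-3) by simp
    ultimately show ?thesis using L len False by (simp add: nth_append r_def)
  qed
qed simp

section \<open>Fergusonian blocks\<close>

text \<open>The clause on the first letter makes the predicate closed under concatenation.\<close>

definition fergusonian_blocks :: "nat \<Rightarrow> nat list \<Rightarrow> bool" where
  "fergusonian_blocks k u \<longleftrightarrow>
     (u \<noteq> [] \<longrightarrow> u ! 0 = 0) \<and>
     (\<forall>n < length u. u ! n \<le> k \<and>
        (u ! n < k - 1 \<longrightarrow> n + 1 < length u \<and> u ! (n + 1) = u ! n + 1) \<and>
        (0 < u ! n \<and> u ! n < k \<longrightarrow> n > 0 \<and> u ! (n - 1) + 1 = u ! n) \<and>
        (n + 1 < length u \<longrightarrow> \<not> (u ! n = k \<and> u ! (n + 1) = k)))"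

text \<open>Only the seam is new. There the last letter of \<open>u\<close> is at least
  \<open>k - 1\<close>, since a smaller one needs its successor inside \<open>u\<close>, and the 0
  that follows needs no predecessor and differs from \<open>k\<close>.\<close>

lemma fergusonian_blocks_append:
  assumes "k \<ge> 2" and u: "fergusonian_blocks k u" and v: "fergusonian_blocks k v"
  shows "fergusonian_blocks k (u @ v)"
proof (cases "u = [] \<or> v = []")
  case True
  then show ?thesis using u v by auto
next
  case False
  have v0: "v ! 0 = 0" and u0: "u ! 0 = 0" using False u v by (auto simp: fergusonian_blocks_def)
  show ?thesis
    unfolding fergusonian_blocks_def
  proof (rule conjI, use False u0 in \<open>simp add: nth_append\<close>, rule allI, rule impI)
    let ?w = "u @ v"
    fix n assume n: "n < length ?w"
    have left: "?w ! i = u ! i" if "i < length u" for i using that by (simp add: nth_append)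
    have right: "?w ! (length u + i) = v ! i" for i by simp
    show "?w ! n \<le> k \<and>
        (?w ! n < k - 1 \<longrightarrow> n + 1 < length ?w \<and> ?w ! (n + 1) = ?w ! n + 1) \<and>
        (0 < ?w ! n \<and> ?w ! n < k \<longrightarrow> n > 0 \<and> ?w ! (n - 1) + 1 = ?w ! n) \<and>
        (n + 1 < length ?w \<longrightarrow> \<not> (?w ! n = k \<and> ?w ! (n + 1) = k))"
    proof (cases "n < length u")
      case True
      note un = u[unfolded fergusonian_blocks_def, THEN conjunct2, rule_format, OF True]
      show ?thesis
      proof (cases "n + 1 < length u")
        case True
        then show ?thesis using un left[of n] left[of "n + 1"] left[of "n - 1"] by auto
      next
        case False
        then have "n + 1 = length u" using True by simp
        then have "?w ! (n + 1) = 0" using right[of 0] v0 by simp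
        then show ?thesis using un False left[of n] left[of "n - 1"] True assms(1) by auto
      qed
    next
      case False
      then obtain m where m: "n = length u + m" by (metis le_Suc_ex not_less)
      have ml: "m < length v" using m n by simp
      note vn = v[unfolded fergusonian_blocks_def, THEN conjunct2, rule_format, OF ml]
      have "?w ! n = v ! m" "?w ! (n + 1) = v ! (m + 1)"
        using right[of m] right[of "m + 1"] m by (simp_all add: add.assoc)
      moreover have "m > 0 \<Longrightarrow> ?w ! (n - 1) = v ! (m - 1)"
        using right[of "m - 1"] m by simp
      ultimately show ?thesis using vn m by auto
    qed
  qed
qed

lemma fergusonian_blocks_Nil: "fergusonian_blocks k []"
  by (simp add: fergusonian_blocks_def)

lemma fergusonian_blocks_upt: "fergusonian_blocks k [0..<k]"
  by (auto simp: fergusonian_blocks_def)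

lemma fergusonian_blocks_upt_Suc: "k \<ge> 2 \<Longrightarrow> fergusonian_blocks k ([0..<k] @ [k])"
  unfolding upt_Suc_append[OF le0, symmetric]
  by (auto simp: fergusonian_blocks_def simp del: upt_Suc)

lemma fergusonian_blocks_word_pow:
  "k \<ge> 2 \<Longrightarrow> fergusonian_blocks k u \<Longrightarrow> fergusonian_blocks k (word_pow u m)"
  by (induction m)
     (simp_all add: word_pow_Suc fergusonian_blocks_append, simp add: word_pow_def fergusonian_blocks_Nil)

lemma fergusonian_blocks_word_tail:
  assumes "k \<ge> 2" "ws 1 = [0..<k]" "q 1 \<ge> 1" "m \<ge> 1"
    and "\<And>l. 1 \<le> l \<Longrightarrow> l \<le> m \<Longrightarrow> fergusonian_blocks k (ws l)"
  shows "fergusonian_blocks k (word_tail ws q k m)"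
  using assms(4,5)
proof (induction m rule: dec_induct)
  case base
  \<comment> \<open>One copy of \<open>[0..<k]\<close> is set aside to stand before the final
    \<open>k\<close>: the word \<open>[k]\<close> alone does not start with 0, which is also why the
    induction begins at 1.\<close>
  obtain c where "q 1 = Suc c" using assms(3) by (cases "q 1") auto
  then have "word_tail ws q k 1 = word_pow [0..<k] c @ ([0..<k] @ [k])"
    using assms(2) by (simp add: word_pow_Suc_right)
  then show ?case
    using assms(1) by (simp only: fergusonian_blocks_append fergusonian_blocks_word_pow
        fergusonian_blocks_upt fergusonian_blocks_upt_Suc)
next
  case (step m)
  then show ?case
    using assms(1) by (simp add: fergusonian_blocks_append fergusonian_blocks_word_pow)
qed

lemma strongly_fergusonian_if_prefixes:
  assumes "k \<ge> 2"
    and "\<And>n. \<exists>u. n < length u \<and> fergusonian_blocks k u \<and> (\<forall>i < length u. u ! i = w i)"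
  shows "strongly_fergusonian k w"
proof -
  have local: "w n \<le> k \<and> (w n < k - 1 \<longrightarrow> w (n + 1) = w n + 1) \<and>
    (0 < w n \<and> w n < k \<longrightarrow> n > 0 \<and> w (n - 1) + 1 = w n) \<and> \<not> (w n = k \<and> w (n + 1) = k)" for n
  proof -
    \<comment> \<open>The conditions at \<open>n\<close> involve only the positions
      \<open>n - 1\<close>, \<open>n\<close> and \<open>n + 1\<close>, so one prefix covering
      \<open>n + 1\<close> decides them.\<close>
    obtain u where u: "n + 1 < length u" "fergusonian_blocks k u" "\<And>i. i < length u \<Longrightarrow> u ! i = w i"
      using assms(2)[of "n + 1"] by blast
    then have n: "n < length u" "n - 1 < length u" by auto
    show ?thesis
      using u(2)[unfolded fergusonian_blocks_def, THEN conjunct2, rule_format, OF n(1)]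
        u(1) u(3)[OF n(1)] u(3)[OF n(2)] u(3)[OF u(1)] by auto
  qed
  show ?thesis
    unfolding strongly_fergusonian_def fergusonian_def
  proof (intro conjI allI impI)
    fix i n assume "i < k - 1" "w n = i + 1"
    then show "n > 0" "w (n - 1) = i" using local[of n] by auto
  qed (use local in auto)
qed

section \<open>The limit word\<close>

theorem theorem4p5:
  fixes k :: nat and p :: "nat \<Rightarrow> nat \<Rightarrow> nat" and ws :: "nat \<Rightarrow> nat list"
  assumes "k \<ge> 2"
    and "ws 1 = [0..<k]"
    and "\<And>i. i > 1 \<Longrightarrow>
      ws i = concat (map (\<lambda>j. word_pow (ws (i - j)) (p i (i - j))) [1..<i]) @ [k]"
    and "\<And>i l. 1 \<le> l \<Longrightarrow> l < i \<Longrightarrow> p i l \<ge> p (i + 1) l"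
    and "\<And>i. i \<ge> 2 \<Longrightarrow> p i 1 \<ge> 1"
    and nondegenerate: "\<And>i. i \<ge> 2 \<Longrightarrow> p i (i - 1) \<ge> 1"
  shows "\<exists>w. word_lim ws w \<and> strongly_fergusonian k w \<and> representation_word w \<and>
    representation_sequence_of w (\<lambda>i. if i = 0 then 1 else length (ws i))"
proof -
  define a where "a = (\<lambda>i. if i = 0 then 1 else length (ws i))"
  have ws_tail: "ws (Suc m) = word_tail ws (p (Suc m)) k m" if "m \<ge> 1" for m
    using assms(3)[of "Suc m"] word_tail_eq_concat[of m "Suc m" ws "p (Suc m)" k] that by simp
  have a_1: "a 1 = k" using assms(2) by (simp add: a_def)
  have a_pos: "a l = length (ws l)" if "l \<ge> 1" for l using that by (simp add: a_def)

  have "a n < a (Suc n)" for n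
  proof (cases "n = 0")
    case True
    then show ?thesis using a_1 assms(1) by (simp add: a_def)
  next
    case False
    then obtain l where l: "n = Suc l" by (cases n) auto
    \<comment> \<open>\<open>ws (Suc n)\<close> contains a full copy of \<open>ws n\<close> and,
      after the powers of \<open>ws n\<close>, a nonempty tail; hence the growth is strict.\<close>
    have "a n \<le> p (Suc n) n * a n" using nondegenerate[of "Suc n"] False by simp
    also have "\<dots> < p (Suc n) n * a n + length (word_tail ws (p (Suc n)) k l)" by simp
    also have "\<dots> = a (Suc n)" using ws_tail[of n] l by (simp add: a_def)
    finally show ?thesis .
  qed
  then have a: "representing_sequence a"
    by (simp add: representing_sequence_def strict_mono_Suc_iff a_def)

  have p_mono: "p i l \<le> p j l" if "1 \<le> l" "l < j" "j \<le> i" for i j l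
    using that(3)
  proof (induction i rule: dec_induct)
    case (step i)
    then show ?case using assms(4)[of l i] that by simp
  qed simp
  \<comment> \<open>Row \<open>i\<close> of the exponents is dominated by row \<open>Suc m\<close>,
    whose tail at level \<open>m\<close> is all of \<open>ws (Suc m)\<close>. For
    \<open>m = 0\<close> the tail is the single letter \<open>k\<close>.\<close>
  have tail_le: "length (word_tail ws (p i) k m) \<le> a (Suc m)" if "m < i" for i m
  proof (cases "m = 0")
    case True
    then show ?thesis using a_1 assms(1) by simp
  next
    case False
    then have "a (Suc m) = length (word_tail ws (p (Suc m)) k m)"
      using ws_tail[of m] by (simp add: a_def)
    then show ?thesis using that p_mono by (auto intro!: length_word_tail_mono)
  qed

  have prefix: "n < a i \<Longrightarrow> ws i ! n = representation_word_of a n" if "i \<ge> 1" for i n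
    using that
  proof (induction i arbitrary: n rule: less_induct)
    case (less i)
    show ?case
    proof (cases "i = 1")
      case True
      then show ?thesis
        using less.prems a_1 assms(2) representation_word_of_less_base[OF a, of n] by simp
    next
      case False
      then obtain m where m: "i = Suc m" "m \<ge> 1" using less.prems by (cases i) auto
      have n: "n < length (word_tail ws (p i) k m)" "a i = length (word_tail ws (p i) k m)"
        using less.prems ws_tail[OF m(2)] m by (simp_all add: a_def)
      show ?thesis
      proof (cases "n + 1 < length (word_tail ws (p i) k m)")
        case True
        have "word_tail ws (p i) k m ! n = representation_word_of a n"
        proof (rule nth_word_tail_eq_representation_word_of[OF a _ _ _ True])
          show "ws l ! n' = representation_word_of a n'" if "1 \<le> l" "l \<le> m" "n' < a l" for l n'
            using less.IH that m by simp
        qed (use a_pos tail_le m in auto)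
        then show ?thesis using ws_tail[OF m(2)] m by simp
      next
        case False
        \<comment> \<open>The final \<open>k\<close> sits at position \<open>a i - 1\<close>, where
          volatility produces the letter \<open>a 1 = k\<close>.\<close>
        then have "n = length (word_tail ws (p i) k m) - 1" using n by simp
        then have "n = a i - 1" "word_tail ws (p i) k m ! n = k"
          using n last_conv_nth[OF word_tail_neq_Nil, of ws "p i" k m] by auto
        then show ?thesis
          using ws_tail[OF m(2)] m representation_word_of_pred[OF a, of i] a_1 by simp
      qed
    qed
  qed

  have blocks: "fergusonian_blocks k (ws i)" if "i \<ge> 1" for i
    using that
  proof (induction i rule: less_induct)
    case (less i)
    show ?case
    proof (cases "i = 1")
      case True
      then show ?thesis using assms(2) by (simp add: fergusonian_blocks_upt)
    next
      case False
      then obtain m where m: "i = Suc m" "m \<ge> 1" using less.prems by (cases i) auto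
      have "fergusonian_blocks k (word_tail ws (p i) k m)"
        by (rule fergusonian_blocks_word_tail) (use assms(1,2,5) m less.IH in auto)
      then show ?thesis using ws_tail[OF m(2)] m by simp
    qed
  qed

  \<comment> \<open>A strictly increasing sequence of naturals satisfies
    \<open>i \<le> a i\<close>.\<close>
  have long: "n < length (ws i)" if "i > n" for i n
    using strict_mono_imp_increasing[of a i] a a_pos[of i] that
    by (simp add: representing_sequence_def)
  have "word_lim ws (representation_word_of a)"
    unfolding word_lim_def
  proof
    fix n
    show "\<forall>\<^sub>F i in sequentially. n < length (ws i) \<and> ws i ! n = representation_word_of a n"
      using eventually_gt_at_top[of n]
      by eventually_elim (use long prefix a_pos in auto)
  qed
  moreover have "strongly_fergusonian k (representation_word_of a)"
  proof (rule strongly_fergusonian_if_prefixes[OF assms(1)])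
    fix n
    show "\<exists>u. n < length u \<and> fergusonian_blocks k u \<and>
        (\<forall>i < length u. u ! i = representation_word_of a i)"
      using long[of n "Suc n"] blocks[of "Suc n"] prefix[of "Suc n"] a_pos[of "Suc n"]
      by (intro exI[of _ "ws (Suc n)"]) auto
  qed
  moreover have "representation_sequence_of (representation_word_of a) a"
    using a by (simp add: representation_sequence_of_def)
  ultimately show ?thesis
    unfolding representation_word_def a_def by blast
qed

end
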